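(* For the classical Kantorovich operators $K_n:C[0,1]\to C[0,1]$ one has, for all $f,g\in C[0,1]$ and all integers $n\ge 1$, the uniform inequality $$\|K_n(fg)-K_nf\cdot K_ng\|_\infty\le\frac14\,\tilde\omega\!\left(f;2\sqrt{\frac{1}{2(n+1)}}\right)\tilde\omega\!\left(g;2\sqrt{\frac{1}{2(n+1)}}\right).$$
   Context: For $n\ge 1$, the classical Kantorovich operator is $$K_n(f;x)=(n+1)\sum_{k=0}^n p_{n,k}(x)\int_{k/(n+1)}^{(k+1)/(n+1)}f(t)\,dt,\qquad p_{n,k}(x)=\binom nk x^k(1-x)^{n-k},\quad x\in[0,1],$$ and $K_nf$ denotes the function $x\mapsto K_n(f;x)$. Functions are real-valued, and $\|\cdot\|_\infty$ is the supremum norm on $[0,1]$. For $f\in C[0,1]$ and $t\in[0,1]$, $\omega_1(f;t)=\sup\{|f(x)-f(y)| : x,y\in[0,1],\ |x-y|\le t\}$ is the first order modulus of continuity, and $\tilde\omega$ is its least concave majorant, given by $$\tilde\omega(f;t)=\sup\left\{\frac{(t-x)\,\omega_1(f;y)+(y-t)\,\omega_1(f;x)}{y-x} : 0\le x\le t\le y\le 1,\ x\ne y\right\}.$$ *)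

theory Defs
  imports "HOL-Analysis.Analysis"
begin

text \<open>
  Elements of $C[0,1]$ are represented by functions on the reals that are continuous on
  \<open>{0..1}\<close>; every notion below depends only on the values of its arguments on \<open>{0..1}\<close>.
  The basis polynomials $p_{n,k}$ are the library's \<^const>\<open>Bernstein\<close>.
\<close>

definition kantorovich :: "nat \<Rightarrow> (real \<Rightarrow> real) \<Rightarrow> real \<Rightarrow> real" where
  "kantorovich n f x =
     (real n + 1) * (\<Sum>k=0..n. Bernstein n k x *
        integral {real k / (real n + 1) .. (real k + 1) / (real n + 1)} f)"

text \<open>
  The suprema below are taken in the reals, so they are meaningful only for nonempty sets that
  are bounded above. This is the case for continuous arguments and \<open>t\<close> in \<open>{0..1}\<close>.
\<close>

definition sup_norm01 :: "(real \<Rightarrow> real) \<Rightarrow> real" where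
  "sup_norm01 h = (SUP x\<in>{0..1}. \<bar>h x\<bar>)"

definition omega1 :: "(real \<Rightarrow> real) \<Rightarrow> real \<Rightarrow> real" where
  "omega1 f t = Sup {\<bar>f x - f y\<bar> | x y. x \<in> {0..1} \<and> y \<in> {0..1} \<and> \<bar>x - y\<bar> \<le> t}"

definition omega_tilde :: "(real \<Rightarrow> real) \<Rightarrow> real \<Rightarrow> real" where
  "omega_tilde f t =
     Sup {((t - x) * omega1 f y + (y - t) * omega1 f x) / (y - x) | x y.
            0 \<le> x \<and> x \<le> t \<and> t \<le> y \<and> y \<le> 1 \<and> x \<noteq> y}"

lemma continuous_on_kantorovich: "continuous_on A (kantorovich n f)"
  unfolding kantorovich_def Bernstein_def by (intro continuous_intros)

end

theory Submission
  imports Defs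
begin

text \<open>
  For fixed \<open>x\<close> in \<open>{0..1}\<close> the functional \<open>L u = kantorovich n u x\<close> is linear, positive and
  maps the constant 1 to 1, so it behaves like an expectation, and the quantity to be bounded is
  a covariance. By the Cauchy-Schwarz inequality it suffices to bound the standard deviation of
  a single \<open>f\<close> by half of \<open>omega_tilde f (2 * \<sigma>)\<close>, where \<open>\<sigma>\<^sup>2\<close> bounds \<open>L (\<lambda>t. (t - x)\<^sup>2)\<close>
  (\<open>variance_le_omega_tilde\<close>).

  The standard deviation is a seminorm. A function that is at most \<open>a / 2\<close> in absolute value has
  standard deviation at most \<open>a / 2\<close>, and a \<open>b\<close>-Lipschitz function has standard deviation at most
  \<open>b * \<sigma>\<close>. Hence one wants to split \<open>f\<close> into two such summands with \<open>a / 2 + b * \<sigma>\<close> equal to half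
  of \<open>omega_tilde f (2 * \<sigma>)\<close>. The numbers \<open>a\<close> and \<open>b\<close> come from a supporting line
  \<open>a + b * s\<close> of the concave majorant at \<open>2 * \<sigma>\<close> (\<open>omega_tilde_supporting_line\<close>). This line
  dominates \<open>omega1 f\<close>, so \<open>f\<close> is \<open>b\<close>-Lipschitz up to an additive error \<open>a\<close>, and such a function
  is within \<open>a / 2\<close> of a \<open>b\<close>-Lipschitz one (\<open>lipschitz_approximation\<close>). This is the half of the
  identity between the K-functional and the concave majorant that the estimate needs.

  For the Kantorovich operator the second moment is computed from the first two factorial moments
  of the Bernstein basis; it is at most \<open>1 / (2 * (n + 1))\<close>, which gives \<open>\<sigma>\<close>. For \<open>n \<ge> 1\<close> the
  argument \<open>2 * \<sigma>\<close> is at most 1, where \<open>omega_tilde\<close> is meaningful.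
\<close>

section \<open>The modulus of continuity and its least concave majorant\<close>

lemma bdd_above_omega1_set:
  fixes f :: "real \<Rightarrow> real"
  assumes "continuous_on {0..1} f"
  shows "bdd_above {\<bar>f x - f y\<bar> | x y. x \<in> {0..1} \<and> y \<in> {0..1} \<and> \<bar>x - y\<bar> \<le> t}"
proof -
  have "compact (f ` {0..1})"
    using assms by (intro compact_continuous_image) auto
  then obtain M where M: "\<And>x. x \<in> {0..1} \<Longrightarrow> \<bar>f x\<bar> \<le> M"
    using compact_imp_bounded[of "f ` {0..1}"] unfolding bounded_iff real_norm_def by blast
  show ?thesis
  proof (rule bdd_aboveI[where M = "2 * M"])
    fix z assume "z \<in> {\<bar>f x - f y\<bar> | x y. x \<in> {0..1} \<and> y \<in> {0..1} \<and> \<bar>x - y\<bar> \<le> t}"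
    then obtain x y where "z = \<bar>f x - f y\<bar>" "x \<in> {0..1}" "y \<in> {0..1}" by blast
    then show "z \<le> 2 * M" using M[of x] M[of y] by linarith
  qed
qed

lemma omega1_upper:
  assumes "continuous_on {0..1} f" "x \<in> {0..1}" "y \<in> {0..1}" "\<bar>x - y\<bar> \<le> t"
  shows "\<bar>f x - f y\<bar> \<le> omega1 f t"
  unfolding omega1_def using assms by (intro cSup_upper bdd_above_omega1_set) auto

lemma omega1_nonneg:
  assumes "continuous_on {0..1} f" "0 \<le> t"
  shows "0 \<le> omega1 f t"
  using omega1_upper[of f 0 0 t] assms by simp

lemma omega1_mono:
  assumes "continuous_on {0..1} f" "0 \<le> s" "s \<le> t"
  shows "omega1 f s \<le> omega1 f t"
  unfolding omega1_def
proof (rule cSup_subset_mono)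
  have "\<bar>f 0 - f 0\<bar> \<in> {\<bar>f x - f y\<bar> | x y. x \<in> {0..1} \<and> y \<in> {0..1} \<and> \<bar>x - y\<bar> \<le> s}"
    using assms(2) by (intro CollectI exI[of _ 0]) auto
  then show "{\<bar>f x - f y\<bar> | x y. x \<in> {0..1} \<and> y \<in> {0..1} \<and> \<bar>x - y\<bar> \<le> s} \<noteq> {}" by blast
  show "{\<bar>f x - f y\<bar> | x y. x \<in> {0..1} \<and> y \<in> {0..1} \<and> \<bar>x - y\<bar> \<le> s}
    \<subseteq> {\<bar>f x - f y\<bar> | x y. x \<in> {0..1} \<and> y \<in> {0..1} \<and> \<bar>x - y\<bar> \<le> t}"
    using assms(3) by force
qed (rule bdd_above_omega1_set[OF assms(1)])

lemma chord_le_omega_tilde: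
  assumes f: "continuous_on {0..1} f" and "0 \<le> x" "x \<le> t" "t \<le> y" "y \<le> 1" "x \<noteq> y"
  shows "((t - x) * omega1 f y + (y - t) * omega1 f x) / (y - x) \<le> omega_tilde f t"
  unfolding omega_tilde_def
proof (rule cSup_upper)
  show "bdd_above {((t - x) * omega1 f y + (y - t) * omega1 f x) / (y - x) | x y.
            0 \<le> x \<and> x \<le> t \<and> t \<le> y \<and> y \<le> 1 \<and> x \<noteq> y}"
  proof (rule bdd_aboveI[where M = "omega1 f 1"])
    fix z assume "z \<in> {((t - x) * omega1 f y + (y - t) * omega1 f x) / (y - x) | x y.
            0 \<le> x \<and> x \<le> t \<and> t \<le> y \<and> y \<le> 1 \<and> x \<noteq> y}"
    then obtain x y where z: "z = ((t - x) * omega1 f y + (y - t) * omega1 f x) / (y - x)"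
      and xy: "0 \<le> x" "x \<le> t" "t \<le> y" "y \<le> 1" "x \<noteq> y" by blast
    have "(t - x) * omega1 f y + (y - t) * omega1 f x
        \<le> (t - x) * omega1 f 1 + (y - t) * omega1 f 1"
      using xy by (intro add_mono mult_left_mono omega1_mono f) auto
    also have "\<dots> = omega1 f 1 * (y - x)" by (simp add: algebra_simps)
    finally show "z \<le> omega1 f 1" using xy by (simp add: z pos_divide_le_eq)
  qed
qed (use assms in blast)

lemma omega1_le_omega_tilde:
  assumes "continuous_on {0..1} f" "0 < t" "t \<le> 1"
  shows "omega1 f t \<le> omega_tilde f t"
  using chord_le_omega_tilde[OF assms(1), of 0 t t] assms(2,3) by simp

text \<open>
  The slope \<open>b\<close> is the infimum of the slopes of the segments that join a point \<open>(x, omega1 f x)\<close>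
  with \<open>0 \<le> x < t\<close> to \<open>(t, omega_tilde f t)\<close>. The line through the latter point is then on or above
  the graph of \<open>omega1 f\<close> left of \<open>t\<close> by the choice of the slope, and right of \<open>t\<close> because a
  point above it there would span, with a suitable point on the left, a chord that passes above
  \<open>(t, omega_tilde f t)\<close>.
\<close>

lemma omega_tilde_supporting_line:
  assumes f: "continuous_on {0..1} f" and t: "0 < t" "t \<le> 1"
  obtains a b where "0 \<le> a" "0 \<le> b" "a + b * t = omega_tilde f t"
    "\<And>s. 0 \<le> s \<Longrightarrow> s \<le> 1 \<Longrightarrow> omega1 f s \<le> a + b * s"
proof -
  define W where "W = omega_tilde f t"
  define slope where "slope = (\<lambda>x. (W - omega1 f x) / (t - x))"
  define b where "b = (INF x\<in>{0..<t}. slope x)"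
  have le_W: "omega1 f x \<le> W" if "0 \<le> x" "x \<le> t" for x
    using omega1_mono[OF f that] omega1_le_omega_tilde[OF f t] by (simp add: W_def)
  have slope_nonneg: "0 \<le> slope x" if "x \<in> {0..<t}" for x
    using le_W[of x] that by (simp add: slope_def)
  then have bdd: "bdd_below (slope ` {0..<t})" by (intro bdd_belowI2)
  have b_nonneg: "0 \<le> b"
    unfolding b_def using t slope_nonneg by (intro cINF_greatest) auto
  have left: "omega1 f x \<le> W - b * (t - x)" if "0 \<le> x" "x < t" for x
  proof -
    have "b \<le> slope x"
      unfolding b_def using that by (intro cINF_lower bdd) auto
    then show ?thesis using that by (simp add: slope_def pos_le_divide_eq)
  qed
  have right: "omega1 f y \<le> W + b * (y - t)" if "t < y" "y \<le> 1" for y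
  proof -
    have "(omega1 f y - W) / (y - t) \<le> b"
      unfolding b_def
    proof (rule cINF_greatest)
      fix x assume "x \<in> {0..<t}"
      then have x: "0 \<le> x" "x < t" by auto
      have "((t - x) * omega1 f y + (y - t) * omega1 f x) / (y - x) \<le> W"
        unfolding W_def using x that by (intro chord_le_omega_tilde f) auto
      then have "(t - x) * omega1 f y + (y - t) * omega1 f x \<le> W * (y - x)"
        using x that by (simp add: pos_divide_le_eq)
      then have "(omega1 f y - W) * (t - x) \<le> (W - omega1 f x) * (y - t)"
        by (simp add: algebra_simps)
      then show "(omega1 f y - W) / (y - t) \<le> slope x"
        using x that by (simp add: slope_def divide_le_eq le_divide_eq mult.commute)
    qed (use t in auto)
    then show ?thesis using that by (simp add: pos_divide_le_eq)
  qed
  show ?thesis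
  proof
    show "0 \<le> W - b * t"
      using left[of 0] omega1_nonneg[OF f, of 0] t by simp
    show "0 \<le> b" by (rule b_nonneg)
    show "W - b * t + b * t = omega_tilde f t" by (simp add: W_def)
    show "omega1 f s \<le> W - b * t + b * s" if "0 \<le> s" "s \<le> 1" for s
    proof (cases s t rule: linorder_cases)
      case less then show ?thesis using left[of s] that by (simp add: algebra_simps)
    next
      case equal then show ?thesis using le_W[of t] t by simp
    next
      case greater then show ?thesis using right[of s] that by (simp add: algebra_simps)
    qed
  qed
qed

section \<open>Lipschitz approximation\<close>

text \<open>
  The approximant is the infimal convolution of \<open>f\<close> with \<open>b * \<bar>x\<bar>\<close>, the largest \<open>b\<close>-Lipschitz
  minorant of \<open>f\<close>. It lies between \<open>f - a\<close> and \<open>f\<close>; raising it by \<open>a / 2\<close> halves the error.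
\<close>

lemma lipschitz_approximation:
  fixes f :: "real \<Rightarrow> real"
  assumes near: "\<And>x y. x \<in> S \<Longrightarrow> y \<in> S \<Longrightarrow> \<bar>f x - f y\<bar> \<le> a + b * \<bar>x - y\<bar>"
    and b: "0 \<le> b"
  obtains g where "b-lipschitz_on S g" "\<And>x. x \<in> S \<Longrightarrow> \<bar>f x - g x\<bar> \<le> a / 2"
proof -
  define g where "g = (\<lambda>x. (INF y\<in>S. f y + b * \<bar>x - y\<bar>))"
  have above: "f x - a \<le> f y + b * \<bar>x - y\<bar>" if "x \<in> S" "y \<in> S" for x y
    using near[OF that] by linarith
  have bdd: "bdd_below ((\<lambda>y. f y + b * \<bar>x - y\<bar>) ` S)" if "x \<in> S" for x
    using above[OF that] by (intro bdd_belowI2)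
  have upper: "g x \<le> f x" if "x \<in> S" for x
    using cINF_lower[OF bdd[OF that] that] by (simp add: g_def)
  have lower: "f x - a \<le> g x" if "x \<in> S" for x
    unfolding g_def using that above by (intro cINF_greatest) auto
  have diff: "g x - b * \<bar>x - z\<bar> \<le> g z" if xz: "x \<in> S" "z \<in> S" for x z
    unfolding g_def
  proof (rule cINF_greatest)
    fix y assume y: "y \<in> S"
    have "(INF y\<in>S. f y + b * \<bar>x - y\<bar>) \<le> f y + b * \<bar>x - y\<bar>"
      by (rule cINF_lower[OF bdd[OF xz(1)] y])
    moreover have "b * \<bar>x - y\<bar> \<le> b * (\<bar>x - z\<bar> + \<bar>z - y\<bar>)"
      using b by (intro mult_left_mono) auto
    ultimately show "(INF y\<in>S. f y + b * \<bar>x - y\<bar>) - b * \<bar>x - z\<bar> \<le> f y + b * \<bar>z - y\<bar>"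
      by (simp add: algebra_simps)
  qed (use xz in auto)
  show ?thesis
  proof
    show "b-lipschitz_on S (\<lambda>x. g x + a / 2)"
    proof (rule lipschitz_onI)
      fix x z assume xz: "x \<in> S" "z \<in> S"
      show "dist (g x + a / 2) (g z + a / 2) \<le> b * dist x z"
        using diff[OF xz] diff[OF xz(2,1)]
        by (simp add: dist_real_def abs_le_iff abs_minus_commute[of z x])
    qed (rule b)
    show "\<bar>f x - (g x + a / 2)\<bar> \<le> a / 2" if "x \<in> S" for x
      using upper[OF that] lower[OF that] by linarith
  qed
qed

section \<open>Covariance of a positive functional\<close>

text \<open>
  The expectation with respect to a probability measure on \<open>{0..1}\<close>, in the form in which it acts
  on continuous functions.
\<close>

locale normalized_positive_functional =
  fixes L :: "(real \<Rightarrow> real) \<Rightarrow> real"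
  assumes add: "continuous_on {0..1} u \<Longrightarrow> continuous_on {0..1} v \<Longrightarrow>
      L (\<lambda>t. u t + v t) = L u + L v"
    and scale: "continuous_on {0..1} u \<Longrightarrow> L (\<lambda>t. c * u t) = c * L u"
    and nonneg: "continuous_on {0..1} u \<Longrightarrow> (\<And>t. t \<in> {0..1} \<Longrightarrow> 0 \<le> u t) \<Longrightarrow> 0 \<le> L u"
    and one: "L (\<lambda>t. 1) = 1"
begin

lemma const: "L (\<lambda>t. c) = c"
  using scale[of "\<lambda>t. 1" c] by (simp add: one)

lemma mono:
  assumes u: "continuous_on {0..1} u" and v: "continuous_on {0..1} v"
    and le: "\<And>t. t \<in> {0..1} \<Longrightarrow> u t \<le> v t"
  shows "L u \<le> L v"
proof -
  have "0 \<le> L (\<lambda>t. v t + (-1) * u t)"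
    using le by (intro nonneg continuous_intros u v) auto
  also have "\<dots> = L v + L (\<lambda>t. (-1) * u t)"
    by (intro add continuous_intros u v)
  also have "\<dots> = L v - L u" using scale[OF u, of "-1"] by simp
  finally show ?thesis by simp
qed

definition cov :: "(real \<Rightarrow> real) \<Rightarrow> (real \<Rightarrow> real) \<Rightarrow> real" where
  "cov u v = L (\<lambda>t. u t * v t) - L u * L v"

lemma cov_add_scale:
  assumes u: "continuous_on {0..1} u" and v: "continuous_on {0..1} v"
  shows "cov (\<lambda>t. u t + s * v t) (\<lambda>t. u t + s * v t) = cov u u + 2 * s * cov u v + s\<^sup>2 * cov v v"
proof -
  have "L (\<lambda>t. (u t + s * v t) * (u t + s * v t))
      = L (\<lambda>t. u t * u t + ((2 * s) * (u t * v t) + s\<^sup>2 * (v t * v t)))"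
    by (simp add: algebra_simps power2_eq_square)
  also have "\<dots> = L (\<lambda>t. u t * u t) + L (\<lambda>t. (2 * s) * (u t * v t) + s\<^sup>2 * (v t * v t))"
    by (intro add continuous_intros u v)
  also have "L (\<lambda>t. (2 * s) * (u t * v t) + s\<^sup>2 * (v t * v t))
      = L (\<lambda>t. (2 * s) * (u t * v t)) + L (\<lambda>t. s\<^sup>2 * (v t * v t))"
    by (intro add continuous_intros u v)
  also have "L (\<lambda>t. (2 * s) * (u t * v t)) = 2 * s * L (\<lambda>t. u t * v t)"
    by (intro scale continuous_intros u v)
  also have "L (\<lambda>t. s\<^sup>2 * (v t * v t)) = s\<^sup>2 * L (\<lambda>t. v t * v t)"
    by (intro scale continuous_intros u v)
  finally have "L (\<lambda>t. (u t + s * v t) * (u t + s * v t))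
      = L (\<lambda>t. u t * u t) + (2 * s * L (\<lambda>t. u t * v t) + s\<^sup>2 * L (\<lambda>t. v t * v t))" .
  moreover have "L (\<lambda>t. u t + s * v t) = L u + s * L v"
    using add[OF u, of "\<lambda>t. s * v t"] scale[OF v, of s] v by (simp add: continuous_on_mult_left)
  ultimately show ?thesis
    by (simp add: cov_def algebra_simps power2_eq_square)
qed

lemma second_moment:
  assumes u: "continuous_on {0..1} u"
  shows "L (\<lambda>t. (u t - c)\<^sup>2) = cov u u + (L u - c)\<^sup>2"
proof -
  have "L (\<lambda>t. (u t - c)\<^sup>2) = L (\<lambda>t. u t * u t + ((-2 * c) * u t + c\<^sup>2))"
    by (simp add: algebra_simps power2_eq_square)
  also have "\<dots> = L (\<lambda>t. u t * u t) + L (\<lambda>t. (-2 * c) * u t + c\<^sup>2)"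
    by (intro add continuous_intros u)
  also have "L (\<lambda>t. (-2 * c) * u t + c\<^sup>2) = L (\<lambda>t. (-2 * c) * u t) + L (\<lambda>t. c\<^sup>2)"
    by (intro add continuous_intros u)
  also have "L (\<lambda>t. (-2 * c) * u t) = (-2 * c) * L u"
    by (intro scale u)
  finally show ?thesis
    by (simp add: const cov_def algebra_simps power2_eq_square)
qed

lemma cov_nonneg:
  assumes "continuous_on {0..1} u"
  shows "0 \<le> cov u u"
proof -
  have "0 \<le> L (\<lambda>t. (u t - L u)\<^sup>2)"
    by (intro nonneg continuous_intros assms) auto
  then show ?thesis by (simp add: second_moment[OF assms])
qed

text \<open>
  The mean minimizes the second moment, so any convenient \<open>c\<close> can replace it: 0 for a bounded
  function, the value at \<open>x\<close> for a Lipschitz function.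
\<close>

lemma cov_le_second_moment:
  assumes u: "continuous_on {0..1} u"
    and v: "continuous_on {0..1} v"
    and le: "\<And>t. t \<in> {0..1} \<Longrightarrow> (u t - c)\<^sup>2 \<le> v t"
  shows "cov u u \<le> L v"
proof -
  have "cov u u \<le> L (\<lambda>t. (u t - c)\<^sup>2)"
    by (simp add: second_moment[OF u])
  also have "\<dots> \<le> L v"
    by (intro mono continuous_intros u v le)
  finally show ?thesis .
qed

lemma cov_Cauchy_Schwarz:
  assumes u: "continuous_on {0..1} u" and v: "continuous_on {0..1} v"
    and "cov u u \<le> \<alpha>\<^sup>2" "cov v v \<le> \<beta>\<^sup>2" "0 \<le> \<alpha>" "0 \<le> \<beta>"
  shows "\<bar>cov u v\<bar> \<le> \<alpha> * \<beta>"
proof -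
  define A where "A = cov u u"
  define D where "D = cov u v"
  define C where "C = cov v v"
  have quad: "0 \<le> A + 2 * s * D + s\<^sup>2 * C" for s
  proof -
    have "0 \<le> cov (\<lambda>t. u t + s * v t) (\<lambda>t. u t + s * v t)"
      by (intro cov_nonneg continuous_intros u v)
    then show ?thesis by (simp add: cov_add_scale[OF u v] A_def D_def C_def)
  qed
  have C: "0 \<le> C" and A: "0 \<le> A" using cov_nonneg[OF u] cov_nonneg[OF v] by (auto simp: A_def C_def)
  have "D\<^sup>2 \<le> A * C"
  proof (cases "C = 0")
    case True
    have "D = 0"
    proof (rule ccontr)
      assume "D \<noteq> 0"
      then show False
        \<comment> \<open>a nonconstant affine function of \<open>s\<close> takes the value \<open>-1\<close>\<close>
        using quad[of "- (A + 1) / (2 * D)"] True by (simp add: field_simps)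
    qed
    then show ?thesis using True by simp
  next
    case False
    with C have "0 < C" by simp
    \<comment> \<open>\<open>- D / C\<close> is the minimizer of the quadratic\<close>
    have "A + 2 * (- D / C) * D + (- D / C)\<^sup>2 * C = A - D\<^sup>2 / C"
      using False by (simp add: field_simps power2_eq_square)
    then have "D\<^sup>2 / C \<le> A" using quad[of "- D / C"] by simp
    then show ?thesis using \<open>0 < C\<close> by (simp add: pos_divide_le_eq)
  qed
  also have "\<dots> \<le> \<alpha>\<^sup>2 * \<beta>\<^sup>2"
    using assms(3,4) A C by (intro mult_mono) (auto simp: A_def C_def)
  finally have "D\<^sup>2 \<le> (\<alpha> * \<beta>)\<^sup>2" by (simp add: power_mult_distrib)
  then show ?thesis
    using abs_le_square_iff[of D "\<alpha> * \<beta>"] assms(5,6) by (simp add: D_def)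
qed

lemma cov_triangle:
  assumes u: "continuous_on {0..1} u" and v: "continuous_on {0..1} v"
    and "cov u u \<le> \<alpha>\<^sup>2" "cov v v \<le> \<beta>\<^sup>2" "0 \<le> \<alpha>" "0 \<le> \<beta>"
  shows "cov (\<lambda>t. u t + v t) (\<lambda>t. u t + v t) \<le> (\<alpha> + \<beta>)\<^sup>2"
proof -
  have "cov (\<lambda>t. u t + v t) (\<lambda>t. u t + v t) = cov u u + 2 * cov u v + cov v v"
    using cov_add_scale[OF u v, of 1] by simp
  also have "\<dots> \<le> \<alpha>\<^sup>2 + 2 * (\<alpha> * \<beta>) + \<beta>\<^sup>2"
    using assms(3,4) cov_Cauchy_Schwarz[OF assms] by linarith
  finally show ?thesis by (simp add: power2_sum algebra_simps)
qed

text \<open>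
  With a supporting line \<open>a + b * s\<close> at \<open>2 * \<sigma>\<close> and a \<open>b\<close>-Lipschitz \<open>g\<close> within \<open>a / 2\<close> of \<open>f\<close>,
  the summands \<open>f - g\<close> and \<open>g\<close> have standard deviations at most \<open>a / 2\<close> and \<open>b * \<sigma>\<close>, whose sum
  is half the value of the line at \<open>2 * \<sigma>\<close>.
\<close>

lemma variance_le_omega_tilde:
  assumes f: "continuous_on {0..1} f" and x: "x \<in> {0..1}"
    and \<sigma>: "0 < \<sigma>" "2 * \<sigma> \<le> 1" and moment: "L (\<lambda>t. (t - x)\<^sup>2) \<le> \<sigma>\<^sup>2"
  shows "cov f f \<le> (omega_tilde f (2 * \<sigma>) / 2)\<^sup>2" and "0 \<le> omega_tilde f (2 * \<sigma>)"
proof -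
  obtain a b where ab: "0 \<le> a" "0 \<le> b" "a + b * (2 * \<sigma>) = omega_tilde f (2 * \<sigma>)"
    and line: "\<And>s. 0 \<le> s \<Longrightarrow> s \<le> 1 \<Longrightarrow> omega1 f s \<le> a + b * s"
    using omega_tilde_supporting_line[OF f, of "2 * \<sigma>"] \<sigma> by auto
  have near: "\<bar>f y - f z\<bar> \<le> a + b * \<bar>y - z\<bar>" if "y \<in> {0..1}" "z \<in> {0..1}" for y z
  proof -
    have "\<bar>y - z\<bar> \<le> 1" using that by auto
    then show ?thesis
      using omega1_upper[OF f that order.refl] line[of "\<bar>y - z\<bar>"] by simp
  qed
  obtain g where lip: "b-lipschitz_on {0..1} g"
    and close: "\<And>y. y \<in> {0..1} \<Longrightarrow> \<bar>f y - g y\<bar> \<le> a / 2"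
    using lipschitz_approximation[where S = "{0..1}" and f = f, OF near ab(2)] by blast
  have g: "continuous_on {0..1} g" by (rule lipschitz_on_continuous_on[OF lip])
  have "cov (\<lambda>t. f t - g t) (\<lambda>t. f t - g t) \<le> L (\<lambda>t. (a / 2)\<^sup>2)"
  proof (rule cov_le_second_moment[where c = 0])
    fix t :: real assume "t \<in> {0..1}"
    then have "\<bar>f t - g t\<bar> \<le> \<bar>a / 2\<bar>" using close[of t] ab(1) by simp
    then show "(f t - g t - 0)\<^sup>2 \<le> (a / 2)\<^sup>2" by (simp only: abs_le_square_iff diff_0_right)
  qed (intro continuous_intros f g)+
  then have var_diff: "cov (\<lambda>t. f t - g t) (\<lambda>t. f t - g t) \<le> (a / 2)\<^sup>2" by (simp add: const)
  have "cov g g \<le> L (\<lambda>t. b\<^sup>2 * (t - x)\<^sup>2)"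
  proof (rule cov_le_second_moment[OF g, where c = "g x"])
    fix t :: real assume "t \<in> {0..1}"
    then have "\<bar>g t - g x\<bar> \<le> \<bar>b * (t - x)\<bar>"
      using lipschitz_onD[OF lip _ x, of t] ab(2) by (simp add: dist_real_def abs_mult)
    then show "(g t - g x)\<^sup>2 \<le> b\<^sup>2 * (t - x)\<^sup>2"
      by (simp only: abs_le_square_iff power_mult_distrib)
  qed (intro continuous_intros)
  also have "\<dots> = b\<^sup>2 * L (\<lambda>t. (t - x)\<^sup>2)" by (intro scale continuous_intros)
  also have "\<dots> \<le> b\<^sup>2 * \<sigma>\<^sup>2" by (intro mult_left_mono moment) auto
  finally have var_g: "cov g g \<le> (b * \<sigma>)\<^sup>2" by (simp add: power_mult_distrib)
  have "cov (\<lambda>t. f t - g t + g t) (\<lambda>t. f t - g t + g t) \<le> (a / 2 + b * \<sigma>)\<^sup>2"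
    using ab \<sigma> by (intro cov_triangle var_diff var_g continuous_intros f g) auto
  moreover have "a / 2 + b * \<sigma> = omega_tilde f (2 * \<sigma>) / 2" using ab(3) by simp
  ultimately show "cov f f \<le> (omega_tilde f (2 * \<sigma>) / 2)\<^sup>2" by simp
  show "0 \<le> omega_tilde f (2 * \<sigma>)" using ab \<sigma> by (simp flip: ab(3))
qed

text \<open>
  The left-hand side is the absolute value of \<open>cov f g\<close>, and each of the two factors \<open>1 / 2\<close> in
  \<open>1 / 4\<close> belongs to the bound of one standard deviation.
\<close>

theorem Gruess_omega_tilde:
  assumes f: "continuous_on {0..1} f" and g: "continuous_on {0..1} g" and x: "x \<in> {0..1}"
    and \<sigma>: "0 < \<sigma>" "2 * \<sigma> \<le> 1" and moment: "L (\<lambda>t. (t - x)\<^sup>2) \<le> \<sigma>\<^sup>2"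
  shows "\<bar>L (\<lambda>t. f t * g t) - L f * L g\<bar>
    \<le> 1 / 4 * omega_tilde f (2 * \<sigma>) * omega_tilde g (2 * \<sigma>)"
  using cov_Cauchy_Schwarz[OF f g variance_le_omega_tilde(1)[OF f x \<sigma> moment]
      variance_le_omega_tilde(1)[OF g x \<sigma> moment]]
    variance_le_omega_tilde(2)[OF f x \<sigma> moment] variance_le_omega_tilde(2)[OF g x \<sigma> moment]
  by (simp add: cov_def)

end

section \<open>The Kantorovich operator\<close>

lemma Kantorovich_cell_subset:
  "k \<le> n \<Longrightarrow> {real k / (real n + 1) .. (real k + 1) / (real n + 1)} \<subseteq> {0..1}"
  by (auto simp: field_simps intro: order_trans)

lemma integrable_on_Kantorovich_cell:
  fixes u :: "real \<Rightarrow> real"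
  assumes "continuous_on {0..1} u" "k \<le> n"
  shows "u integrable_on {real k / (real n + 1) .. (real k + 1) / (real n + 1)}"
  using integrable_continuous_real[OF
      continuous_on_subset[OF assms(1) Kantorovich_cell_subset[OF assms(2)]]] .

lemma kantorovich_normalized_positive:
  assumes x: "x \<in> {0..1}"
  shows "normalized_positive_functional (\<lambda>u. kantorovich n u x)"
proof
  fix u v :: "real \<Rightarrow> real" and c :: real
  assume u: "continuous_on {0..1} u"
  show "kantorovich n (\<lambda>t. c * u t) x = c * kantorovich n u x"
    unfolding kantorovich_def by (simp add: sum_distrib_left mult_ac)
  show "0 \<le> kantorovich n u x" if "\<And>t. t \<in> {0..1} \<Longrightarrow> 0 \<le> u t"
    unfolding kantorovich_def
  proof (intro mult_nonneg_nonneg sum_nonneg)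
    fix k assume "k \<in> {0..n}"
    then have k: "k \<le> n" by simp
    show "0 \<le> Bernstein n k x" using x by (intro Bernstein_nonneg) auto
    show "0 \<le> integral {real k / (real n + 1) .. (real k + 1) / (real n + 1)} u"
      by (intro integral_nonneg integrable_on_Kantorovich_cell u k that
          subsetD[OF Kantorovich_cell_subset[OF k]])
  qed simp
  assume v: "continuous_on {0..1} v"
  have "(\<Sum>k=0..n. Bernstein n k x *
          integral {real k / (real n + 1) .. (real k + 1) / (real n + 1)} (\<lambda>t. u t + v t))
      = (\<Sum>k=0..n. Bernstein n k x *
          (integral {real k / (real n + 1) .. (real k + 1) / (real n + 1)} u
         + integral {real k / (real n + 1) .. (real k + 1) / (real n + 1)} v))"
    by (intro sum.cong refl arg_cong2[where f = "(*)"] integral_add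
        integrable_on_Kantorovich_cell u v) auto
  then show "kantorovich n (\<lambda>t. u t + v t) x = kantorovich n u x + kantorovich n v x"
    unfolding kantorovich_def by (simp add: distrib_left sum.distrib)
next
  have "(real k + 1) / (real n + 1) - real k / (real n + 1) = 1 / (real n + 1)" for k
    by (simp flip: diff_divide_distrib)
  moreover have "real k / (real n + 1) \<le> (real k + 1) / (real n + 1)" for k
    by (intro divide_right_mono) auto
  ultimately have "kantorovich n (\<lambda>t. 1) x = (real n + 1) * (\<Sum>k=0..n. Bernstein n k x * (1 / (real n + 1)))"
    unfolding kantorovich_def by simp
  also have "\<dots> = 1"
    unfolding atLeast0AtMost sum_distrib_right[symmetric] sum_Bernstein by simp
  finally show "kantorovich n (\<lambda>t. 1) x = 1" .
qed

lemma sum_Bernstein_quadratic: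
  "(\<Sum>k\<le>n. Bernstein n k x * (real k * (real k - 1) + c * real k + d))
    = real n * (real n - 1) * x\<^sup>2 + c * (real n * x) + d"
proof -
  have "(\<Sum>k\<le>n. Bernstein n k x * (real k * (real k - 1) + c * real k + d))
      = (\<Sum>k\<le>n. real k * (real k - 1) * Bernstein n k x)
        + c * (\<Sum>k\<le>n. real k * Bernstein n k x) + d * (\<Sum>k\<le>n. Bernstein n k x)"
    unfolding sum_distrib_left sum.distrib[symmetric]
    by (intro sum.cong refl) (simp add: algebra_simps)
  then show ?thesis
    by (simp only: sum_Bernstein sum_k_Bernstein sum_kk_Bernstein mult_1_right)
qed

text \<open>
  Integrating over a cell turns \<open>(t - x)\<^sup>2\<close> into a quadratic polynomial in the index \<open>k\<close>. Written in
  terms of \<open>k * (k - 1)\<close>, \<open>k\<close> and 1 it is averaged by the moment identities of the Bernstein basis.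
\<close>

lemma kantorovich_second_moment:
  "kantorovich n (\<lambda>t. (t - x)\<^sup>2) x = ((real n - 1) * x * (1 - x) + 1 / 3) / (real n + 1)\<^sup>2"
proof -
  define N where "N = real n + 1"
  have N: "N > 0" by (simp add: N_def)
  have cell: "integral {real k / N .. (real k + 1) / N} (\<lambda>t. (t - x)\<^sup>2)
      = ((real k - N * x)\<^sup>2 + (real k - N * x) + 1 / 3) / N ^ 3" for k
  proof -
    have "((\<lambda>t. (t - x)\<^sup>2) has_integral
        ((real k + 1) / N - x) ^ 3 / 3 - (real k / N - x) ^ 3 / 3) {real k / N .. (real k + 1) / N}"
    proof (rule fundamental_theorem_of_calculus)
      show "real k / N \<le> (real k + 1) / N" using N by (intro divide_right_mono) auto
      show "((\<lambda>t. (t - x) ^ 3 / 3) has_vector_derivative (t - x)\<^sup>2)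
          (at t within {real k / N .. (real k + 1) / N})" for t
        unfolding has_real_derivative_iff_has_vector_derivative[symmetric]
        by (auto intro!: derivative_eq_intros)
    qed
    moreover have "((real k + 1) / N - x) ^ 3 / 3 - (real k / N - x) ^ 3 / 3
        = ((real k - N * x)\<^sup>2 + (real k - N * x) + 1 / 3) / N ^ 3"
      using N by (simp add: field_simps power2_eq_square power3_eq_cube)
    ultimately show ?thesis by (simp add: integral_unique)
  qed
  have split: "(real k - N * x)\<^sup>2 + (real k - N * x) + 1 / 3
      = real k * (real k - 1) + (2 - 2 * N * x) * real k + (N\<^sup>2 * x\<^sup>2 - N * x + 1 / 3)" for k
    by (simp add: algebra_simps power2_eq_square)
  have "(\<Sum>k\<le>n. Bernstein n k x * ((real k - N * x)\<^sup>2 + (real k - N * x) + 1 / 3))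
      = real n * (real n - 1) * x\<^sup>2 + (2 - 2 * N * x) * (real n * x)
      + (N\<^sup>2 * x\<^sup>2 - N * x + 1 / 3)"
    unfolding split by (rule sum_Bernstein_quadratic)
  also have "\<dots> = (real n - 1) * x * (1 - x) + 1 / 3"
    by (simp add: N_def algebra_simps power2_eq_square)
  finally have "(\<Sum>k\<le>n. Bernstein n k x * ((real k - N * x)\<^sup>2 + (real k - N * x) + 1 / 3))
      = (real n - 1) * x * (1 - x) + 1 / 3" .
  moreover have "kantorovich n (\<lambda>t. (t - x)\<^sup>2) x
      = N * ((\<Sum>k\<le>n. Bernstein n k x * ((real k - N * x)\<^sup>2 + (real k - N * x) + 1 / 3)) / N ^ 3)"
    unfolding kantorovich_def N_def[symmetric] cell
    by (simp add: atLeast0AtMost sum_divide_distrib)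
  ultimately show ?thesis
    using N by (simp add: N_def[symmetric] power2_eq_square power3_eq_cube)
qed

lemma kantorovich_second_moment_le:
  assumes "n \<ge> 1"
  shows "kantorovich n (\<lambda>t. (t - x)\<^sup>2) x \<le> 1 / (2 * (real n + 1))"
proof -
  have "x * (1 - x) \<le> 1 / 4"
    using zero_le_power2[of "x - 1 / 2"] by (simp add: power2_eq_square algebra_simps)
  then have "(real n - 1) * (x * (1 - x)) \<le> (real n - 1) * (1 / 4)"
    using assms by (intro mult_left_mono) auto
  also have "(real n - 1) * (1 / 4) \<le> (real n + 1) / 2 - 1 / 3"
    by (simp add: field_simps)
  finally have "(real n - 1) * (x * (1 - x)) + 1 / 3 \<le> (real n + 1) / 2"
    by (simp only: le_diff_eq)
  then have "((real n - 1) * (x * (1 - x)) + 1 / 3) / (real n + 1)\<^sup>2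
      \<le> ((real n + 1) / 2) / (real n + 1)\<^sup>2"
    by (intro divide_right_mono) auto
  then show ?thesis
    unfolding kantorovich_second_moment by (simp add: power2_eq_square mult.assoc)
qed

theorem theorem4p2:
  fixes f g :: "real \<Rightarrow> real" and n :: nat
  assumes "continuous_on {0..1} f" and "continuous_on {0..1} g" and "n \<ge> 1"
  shows "sup_norm01 (\<lambda>x. kantorovich n (\<lambda>t. f t * g t) x - kantorovich n f x * kantorovich n g x)
    \<le> 1 / 4 * omega_tilde f (2 * sqrt (1 / (2 * (real n + 1))))
            * omega_tilde g (2 * sqrt (1 / (2 * (real n + 1))))"
  unfolding sup_norm01_def
proof (rule cSUP_least)
  fix x :: real assume x: "x \<in> {0..1}"
  define \<sigma> where "\<sigma> = sqrt (1 / (2 * (real n + 1)))"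
  interpret normalized_positive_functional "\<lambda>u. kantorovich n u x"
    by (rule kantorovich_normalized_positive[OF x])
  have sq: "\<sigma>\<^sup>2 = 1 / (2 * (real n + 1))" by (simp add: \<sigma>_def)
  have "\<sigma> \<le> sqrt ((1 / 2)\<^sup>2)"
    unfolding \<sigma>_def using assms(3)
    by (intro real_sqrt_le_mono) (simp add: field_simps power2_eq_square)
  then have "0 < \<sigma>" "2 * \<sigma> \<le> 1" by (simp_all add: \<sigma>_def)
  then show "\<bar>kantorovich n (\<lambda>t. f t * g t) x - kantorovich n f x * kantorovich n g x\<bar>
    \<le> 1 / 4 * omega_tilde f (2 * sqrt (1 / (2 * (real n + 1))))
            * omega_tilde g (2 * sqrt (1 / (2 * (real n + 1))))"
    unfolding \<sigma>_def[symmetric]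
    using kantorovich_second_moment_le[OF assms(3), of x]
    by (intro Gruess_omega_tilde[OF assms(1,2) x]) (simp_all only: sq)
qed simp

end
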